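(* Let $D \ge 2$ be an integer and let $\bm{l}$ be a random vector in $\mathbb{R}^{D-1}$ which, under each hypothesis $H_i$, $i \in \{1,\dots,D\}$, has a strictly positive probability density function $f_{\mathcal{L}_i}$ on $\mathbb{R}^{D-1}$ (with respect to Lebesgue measure). Assume that $\bm{l}$ is perfectly calibrated, i.e. the idempotence property holds: $$\operatorname{ilr}\big([f_{\mathcal{L}_1}(\bm{l}),\dots,f_{\mathcal{L}_D}(\bm{l})]^T\big) = \bm{l} \qquad \text{for all } \bm{l}\in\mathbb{R}^{D-1}.$$ If $\bm{l}\mid H_1 \sim \mathcal{N}(\bm{\mu}_1,\bm{\Sigma})$ for some $\bm{\mu}_1\in\mathbb{R}^{D-1}$ and some symmetric positive definite matrix $\bm{\Sigma}\in\mathbb{R}^{(D-1)\times(D-1)}$, then for all $i\in\{2,\dots,D\}$, $\bm{l}\mid H_i\sim\mathcal{N}(\bm{\mu}_i,\bm{\Sigma})$, where $$\bm{\mu}_i = \bm{\mu}_1 - \bm{\Sigma}\bm{a}_{i-1} - \sum_{j=1}^{i-2}\frac{1}{j+1}\bm{\Sigma}\bm{a}_j,$$ and $$\bm{\mu}_1 = \bm{A}^{-1}\bm{B}\operatorname{vec}(\bm{\Sigma}).$$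
   Context: Isometric-log-ratio transformation: for $\bm{p}=[p_1,\dots,p_D]^T$ with all $p_j>0$, $\operatorname{ilr}(\bm{p})\in\mathbb{R}^{D-1}$ is the vector whose $i$th component, $1\le i\le D-1$, is $$\frac{1}{\sqrt{i(i+1)}}\log\left(\frac{\prod_{j=1}^{i}p_j}{(p_{i+1})^{i}}\right).$$ For $i\in\{1,\dots,D-1\}$, $\bm{a}_i=\sqrt{\frac{i+1}{i}}\,\bm{e}_i$, where $\bm{e}_i$ is the $i$th vector of the standard basis of $\mathbb{R}^{D-1}$. Empty sums are zero. $\operatorname{vec}(\bm{\Sigma})\in\mathbb{R}^{(D-1)^2}$ is the (column-stacking) vectorization of $\bm{\Sigma}$. $\bm{A}=(\alpha_{ij})_{1\le i,j\le D-1}$ is the (lower triangular, invertible) real matrix with $\alpha_{ij}=2\sqrt{\frac{i+1}{i}}$ if $i=j$, $\alpha_{ij}=\frac{2}{\sqrt{j(j+1)}}$ if $j<i$, and $\alpha_{ij}=0$ otherwise. $\bm{B}=[\bm{B}^{(1)}\ \bm{B}^{(2)}\ \cdots\ \bm{B}^{(D-1)}]$ is the real $(D-1)\times(D-1)^2$ block matrix whose $b$th block $\bm{B}^{(b)}=(\beta^{(b)}_{ij})_{1\le i,j\le D-1}$ is given by: $\beta^{(b)}_{ij}=\frac{b+1}{b}$ if $i=j=b$; $\beta^{(b)}_{ij}=2\sqrt{\frac{i+1}{i\,b(b+1)}}$ if $i=j$ and $b<i$; $\beta^{(b)}_{ij}=\frac{1}{\sqrt{j\,b\,(j+1)(b+1)}}$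 if $b<i$ and $j<i$; and $\beta^{(b)}_{ij}=0$ otherwise. *)

theory Defs
  imports "HOL-Probability.Probability"
begin

(* The elements of the well-ordered index type are numbered 1, ..., CARD('n) in increasing order,
   so that real ^ 'n is R^(D - 1) when CARD('n) = D - 1. *)
definition pos :: "'n::{finite,wellorder} \<Rightarrow> nat" where
  "pos k = card {..k}"

lemma strict_mono_pos: "strict_mono (pos :: 'n::{finite,wellorder} \<Rightarrow> nat)"
  unfolding strict_mono_def pos_def by (auto intro!: psubset_card_mono)

lemma bij_betw_pos: "bij_betw (pos :: 'n::{finite,wellorder} \<Rightarrow> nat) UNIV {1..CARD('n)}"
proof -
  have inj: "inj (pos :: 'n \<Rightarrow> nat)"
    using strict_mono_pos strict_mono_imp_inj_on by blast
  have "pos k \<in> {1..CARD('n)}" for k :: 'n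
  proof -
    have "card {..k} \<le> CARD('n)" by (rule card_mono) auto
    moreover have "0 < card {..k}" by (auto simp: card_gt_0_iff)
    ultimately show ?thesis by (simp add: pos_def)
  qed
  hence "range (pos :: 'n \<Rightarrow> nat) \<subseteq> {1..CARD('n)}" by blast
  moreover have "card (range (pos :: 'n \<Rightarrow> nat)) = card {1..CARD('n)}"
    using inj by (simp add: card_image)
  ultimately have "range (pos :: 'n \<Rightarrow> nat) = {1..CARD('n)}"
    by (intro card_subset_eq) auto
  with inj show ?thesis by (simp add: bij_betw_def)
qed

(* A vector of R^D is given by its components p 1, ..., p D, with D = CARD('n) + 1. *)
definition ilr :: "(nat \<Rightarrow> real) \<Rightarrow> real ^ 'n::{finite,wellorder}" where
  "ilr p = (\<chi> k. let i = pos k in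
     1 / sqrt (real i * (real i + 1)) * ln ((\<Prod>j=1..i. p j) / p (i + 1) ^ i))"

definition std_basis :: "nat \<Rightarrow> real ^ 'n::{finite,wellorder}" where
  "std_basis i = (\<chi> k. if pos k = i then 1 else 0)"

definition avec :: "nat \<Rightarrow> real ^ 'n::{finite,wellorder}" where
  "avec i = sqrt ((real i + 1) / real i) *\<^sub>R std_basis i"

definition alpha :: "nat \<Rightarrow> nat \<Rightarrow> real" where
  "alpha i j =
     (if i = j then 2 * sqrt ((real i + 1) / real i)
      else if j < i then 2 / sqrt (real j * (real j + 1))
      else 0)"

definition Amat :: "real ^ ('n::{finite,wellorder}) ^ ('n::{finite,wellorder})" where
  "Amat = (\<chi> r c. alpha (pos r) (pos c))"

(* Hence matrix_inv Amat is the genuine inverse. *)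
lemma invertible_Amat: "invertible (Amat :: real ^ ('n::{finite,wellorder}) ^ ('n::{finite,wellorder}))"
proof -
  have "det (Amat :: real ^ ('n::_) ^ ('n::_)) = (\<Prod>k\<in>UNIV. (Amat :: real ^ ('n::_) ^ ('n::_)) $ k $ k)"
  proof (rule det_lowerdiagonal)
    fix r c :: 'n assume "r < c"
    hence "pos r < pos c" by (rule strict_monoD[OF strict_mono_pos])
    thus "(Amat :: real ^ ('n::_) ^ ('n::_)) $ r $ c = 0" by (simp add: Amat_def alpha_def)
  qed
  moreover have "(Amat :: real ^ ('n::_) ^ ('n::_)) $ k $ k \<noteq> 0" for k :: 'n
  proof -
    have "pos k \<noteq> 0" by (auto simp: pos_def card_eq_0_iff)
    thus ?thesis by (simp add: Amat_def alpha_def)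
  qed
  ultimately have "det (Amat :: real ^ ('n::_) ^ ('n::_)) \<noteq> 0" by simp
  thus ?thesis by (simp add: invertible_det_nz)
qed

definition beta :: "nat \<Rightarrow> nat \<Rightarrow> nat \<Rightarrow> real" where
  "beta b i j =
     (if i = j \<and> j = b then (real b + 1) / real b
      else if i = j \<and> b < i then 2 * sqrt ((real i + 1) / (real i * real b * (real b + 1)))
      else if b < i \<and> j < i then 1 / sqrt (real j * real b * (real j + 1) * (real b + 1))
      else 0)"

(* The column index (u, v) of Bmat is column v of block u. Accordingly, entry (u, v) of
   the column-stacking vectorization is entry v of column u. *)
definition Bmat :: "real ^ (('n::{finite,wellorder}) \<times> ('n::{finite,wellorder})) ^ ('n::{finite,wellorder})" where
  "Bmat = (\<chi> r c. beta (pos (fst c)) (pos r) (pos (snd c)))"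

definition vectorize :: "real ^ 'n ^ 'n \<Rightarrow> real ^ ('n \<times> 'n)" where
  "vectorize S = (\<chi> c. S $ snd c $ fst c)"

definition sym_pos_def :: "real ^ 'n ^ 'n \<Rightarrow> bool" where
  "sym_pos_def S \<longleftrightarrow> transpose S = S \<and> (\<forall>x. x \<noteq> 0 \<longrightarrow> 0 < x \<bullet> (S *v x))"

definition mvn_density :: "real ^ 'n \<Rightarrow> real ^ 'n ^ 'n \<Rightarrow> real ^ 'n \<Rightarrow> real" where
  "mvn_density m S x =
     exp (- ((x - m) \<bullet> (matrix_inv S *v (x - m))) / 2) / sqrt ((2 * pi) ^ CARD('n) * det S)"

definition mvn_distributed ::
  "'a measure \<Rightarrow> ('a \<Rightarrow> real ^ 'n) \<Rightarrow> real ^ 'n \<Rightarrow> real ^ 'n ^ 'n \<Rightarrow> bool" where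
  "mvn_distributed M X m S \<longleftrightarrow> distributed M lborel X (mvn_density m S)"

end

(* Solving ilr(f_1(x), ..., f_D(x)) = x for the ratios gives f_{m+1}(x) = f_1(x) exp(- c_m . x),
   where 2 c_m is the m-th row of A. Tilting the normal density with parameters mu_1, Sigma by this
   exponential gives, by completing the square, the normal density with parameters
   mu_1 - Sigma c_m, Sigma, up to the constant exp(c_m . Sigma c_m / 2 - c_m . mu_1).
   Both densities have mass 1, so 2 c_m . mu_1 = c_m . Sigma c_m for every m, and these D - 1
   equations are the rows of A mu_1 = B vec(Sigma). *)
theory Submission
  imports Defs
begin

section \<open>Solving the ilr equations recursively\<close>

lemma sqrt_mult_Suc:
  assumes "0 < m"
  shows "sqrt (real m * (real m + 1)) = real m * sqrt ((real m + 1) / real m)"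
    and "1 / (real m + 1) * sqrt ((real m + 1) / real m) = 1 / sqrt (real m * (real m + 1))"
proof -
  let ?r = "sqrt (real m * (real m + 1))"
  have r: "?r * ?r = real m * (real m + 1)" "?r \<noteq> 0" using assms by auto
  have "sqrt ((real m + 1) / real m) = sqrt (real m * (real m + 1) / (real m)\<^sup>2)"
    using assms by (simp add: power2_eq_square)
  also have "\<dots> = ?r / real m" by (simp add: real_sqrt_divide)
  finally have s: "sqrt ((real m + 1) / real m) = ?r / real m" .
  show "?r = real m * sqrt ((real m + 1) / real m)" using assms by (simp add: s)
  have "1 / (real m + 1) * (?r / real m) = ?r / (?r * ?r)" unfolding r(1) by (simp add: mult.commute)
  also have "\<dots> = 1 / ?r" using r(2) by (simp del: real_sqrt_mult_self)
  finally show "1 / (real m + 1) * sqrt ((real m + 1) / real m) = 1 / ?r" unfolding s .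
qed

text \<open>Meant for \<open>y j\<close> the logarithm of the j-th likelihood and \<open>L m\<close>
  the m-th coordinate of the ilr vector. The m-th equation involves only \<open>y 1\<close>, ...,
  \<open>y (m + 1)\<close>, so everything is determined successively from
  \<open>y 1\<close>.\<close>

lemma ilr_recursion:
  fixes y L :: "nat \<Rightarrow> real"
  assumes step: "\<And>m. m \<in> {1..n} \<Longrightarrow> (\<Sum>j=1..m. y j) - real m * y (m + 1) = sqrt (real m * (real m + 1)) * L m"
    and m: "m \<in> {1..n}"
  shows "y (m + 1) = y 1 - sqrt ((real m + 1) / real m) * L m
           - (\<Sum>j=1..m-1. L j / sqrt (real j * (real j + 1)))"
proof -
  \<comment> \<open>The coordinates of ilr drive the running means of \<open>y\<close> by a telescoping recursion.\<close>
  have mean: "(\<Sum>j=1..m. y j) = real m * (y 1 - (\<Sum>j=1..m-1. L j / sqrt (real j * (real j + 1))))"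
    if "1 \<le> m" "m \<le> n" for m
    using that
  proof (induction m rule: dec_induct)
    case (step m)
    let ?r = "sqrt (real m * (real m + 1))"
    let ?S = "\<Sum>j=1..m-1. L j / sqrt (real j * (real j + 1))"
    have r: "?r * ?r = real m * (real m + 1)" "?r \<noteq> 0" using step.hyps by auto
    have IH: "(\<Sum>j=1..m. y j) = real m * (y 1 - ?S)" using step by simp
    have "real m * y (m + 1) = real m * (y 1 - ?S) - ?r * L m"
      using assms(1)[of m] IH step by simp
    moreover have "?r * L m = real m * (real m + 1) * (L m / ?r)"
      using r by (simp add: field_simps)
    ultimately have "real m * y (m + 1) = real m * (y 1 - ?S - (real m + 1) * (L m / ?r))"
      by (simp add: algebra_simps)
    hence y: "y (m + 1) = y 1 - ?S - (real m + 1) * (L m / ?r)" using step.hyps by simp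
    have S: "(\<Sum>j=1..m. L j / sqrt (real j * (real j + 1))) = ?S + L m / ?r"
      using step.hyps by (cases m) auto
    have "(\<Sum>j=1..Suc m. y j) = real m * (y 1 - ?S) + y (m + 1)" using IH by simp
    also have "\<dots> = (real m + 1) * (y 1 - (?S + L m / ?r))"
      unfolding y by (simp add: algebra_simps)
    finally show ?case using S by (simp add: algebra_simps)
  qed simp
  have "real m * y (m + 1) = real m * (y 1 - sqrt ((real m + 1) / real m) * L m
           - (\<Sum>j=1..m-1. L j / sqrt (real j * (real j + 1))))"
    using step[OF m] mean[of m] m sqrt_mult_Suc(1)[of m] by (simp add: algebra_simps)
  thus ?thesis using m by simp
qed

section \<open>The vectors c_m, written as in the formula for the means, and the rows of A and
  B\<close>

definition tilt_vec :: "nat \<Rightarrow> real ^ 'n::{finite,wellorder}" where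
  "tilt_vec m = avec m + (\<Sum>j=1..m-1. (1 / (real j + 1)) *\<^sub>R avec j)"

lemma pos_gt_0: "0 < pos (k :: 'n::{finite,wellorder})"
  by (auto simp: pos_def card_gt_0_iff)

lemma pos_eq_iff: "pos j = pos k \<longleftrightarrow> j = (k :: 'n::{finite,wellorder})"
  using bij_betw_pos[where 'n = 'n] by (auto simp: bij_betw_def inj_on_def)

text \<open>At most one term of the sum reaches coordinate \<open>k\<close>, the one with
  \<open>j = pos k\<close>, and its weight collapses to a single square root.\<close>

lemma tilt_vec_nth:
  assumes "0 < m"
  shows "tilt_vec m $ (k :: 'n::{finite,wellorder}) = alpha m (pos k) / 2"
proof -
  have "(\<Sum>j=1..m-1. 1 / (real j + 1) * (avec j $ k)) =
      (\<Sum>j=1..m-1. if j = pos k then 1 / (real j + 1) * sqrt ((real j + 1) / real j) else 0)"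
    by (intro sum.cong) (auto simp: avec_def std_basis_def)
  also have "\<dots> = (if pos k < m then 1 / sqrt (real (pos k) * (real (pos k) + 1)) else 0)"
    using pos_gt_0[of k] sqrt_mult_Suc(2)[of "pos k"] by (auto simp: sum.delta)
  finally show ?thesis
    by (auto simp: tilt_vec_def alpha_def avec_def std_basis_def)
qed

lemma Amat_mult: "(Amat *v x) $ r = 2 * (tilt_vec (pos r) \<bullet> x)"
  by (simp add: Amat_def matrix_vector_mult_def inner_vec_def tilt_vec_nth pos_gt_0 sum_distrib_left)

text \<open>B is not symmetric in block and column: for \<open>b < i\<close> and
  \<open>j = i\<close> the whole cross term sits in block \<open>b\<close>, and the entry with
  \<open>b\<close> and \<open>j\<close> exchanged is 0. The two entries are therefore added before
  the comparison with A.\<close>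

lemma alpha_beta:
  assumes "0 < i"
  shows "alpha i b * alpha i j = 2 * (beta b i j + beta j i b)"
proof -
  have "sqrt (real j * real b * (real j + 1) * (real b + 1))
      = sqrt (real j * (real j + 1)) * sqrt (real b * (real b + 1))" for j b
    by (simp add: real_sqrt_mult[symmetric] mult_ac)
  moreover have "sqrt ((real i + 1) / (real i * real b * (real b + 1)))
      = sqrt ((real i + 1) / real i) / sqrt (real b * (real b + 1))" for b
    by (simp add: real_sqrt_divide[symmetric] mult_ac)
  ultimately show ?thesis
    using assms by (auto simp: alpha_def beta_def)
qed

text \<open>A symmetric \<open>S\<close> sees only the symmetrised coefficients of B, which
  \<open>alpha_beta\<close> identifies with products of coordinates of
  \<open>tilt_vec\<close>.\<close>

lemma Bmat_mult:
  assumes "transpose S = S"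
  shows "(Bmat *v vectorize S) $ r = tilt_vec (pos r) \<bullet> (S *v tilt_vec (pos r))"
proof -
  let ?c = "tilt_vec (pos r)" and ?\<beta> = "\<lambda>u v. beta (pos u) (pos r) (pos v)"
  have sym: "S $ u $ v = S $ v $ u" for u v
    using assms by (metis transpose_def vec_lambda_beta)
  have pair: "?c $ u * ?c $ v + ?c $ v * ?c $ u = ?\<beta> u v + ?\<beta> v u" for u v
    using alpha_beta[of "pos r" "pos u" "pos v"] by (simp add: tilt_vec_nth pos_gt_0 mult.commute)
  have B: "(Bmat *v vectorize S) $ r = (\<Sum>u\<in>UNIV. \<Sum>v\<in>UNIV. ?\<beta> u v * S $ v $ u)"
    by (simp add: Bmat_def vectorize_def matrix_vector_mult_def sum.cartesian_product
          UNIV_Times_UNIV[symmetric] case_prod_unfold del: UNIV_Times_UNIV)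
  \<comment> \<open>Exchanging the summation indices and using the symmetry of \<open>S\<close>
    gives the same value with block and column swapped; adding both forms explains the factor 2
    below.\<close>
  have B': "(Bmat *v vectorize S) $ r = (\<Sum>u\<in>UNIV. \<Sum>v\<in>UNIV. ?\<beta> v u * S $ v $ u)"
    unfolding B by (subst sum.swap) (simp add: sym)
  have C: "?c \<bullet> (S *v ?c) = (\<Sum>u\<in>UNIV. \<Sum>v\<in>UNIV. ?c $ u * ?c $ v * S $ v $ u)"
    by (simp add: inner_vec_def matrix_vector_mult_def sum_distrib_left sym mult_ac)
  have "2 * (?c \<bullet> (S *v ?c)) =
      (\<Sum>u\<in>UNIV. \<Sum>v\<in>UNIV. (?c $ u * ?c $ v + ?c $ v * ?c $ u) * S $ v $ u)"
    unfolding C by (simp add: sum_distrib_left algebra_simps)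
  also have "\<dots> = 2 * (Bmat *v vectorize S) $ r"
    unfolding pair distrib_right sum.distrib B[symmetric] B'[symmetric] by simp
  finally show ?thesis by simp
qed

section \<open>From calibration to an exponential tilt\<close>

lemma ilr_fixed_point:
  fixes x :: "real ^ 'n::{finite,wellorder}"
  assumes ilr: "ilr p = x" and p: "\<And>i. i \<in> {1..CARD('n) + 1} \<Longrightarrow> p i > 0"
    and m: "m \<in> {1..CARD('n)}"
  shows "p (m + 1) = p 1 * exp (- (tilt_vec m \<bullet> x))"
proof -
  let ?L = "\<lambda>j. std_basis j \<bullet> x"
  \<comment> \<open>Logarithms make the ilr coordinates linear in the \<open>ln (p j)\<close>, in
    the form required by \<open>ilr_recursion\<close>.\<close>
  have step: "(\<Sum>j=1..m. ln (p j)) - real m * ln (p (m + 1)) = sqrt (real m * (real m + 1)) * ?L m"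
    if m: "m \<in> {1..CARD('n)}" for m
  proof -
    obtain k :: 'n where k: "m = pos k" using m bij_betw_imp_surj_on[OF bij_betw_pos[where 'n='n]] by blast
    have "?L m = x $ k"
      by (simp add: inner_vec_def std_basis_def k pos_eq_iff if_distrib[of "\<lambda>t. t * _"] cong: if_cong)
    also have "\<dots> = 1 / sqrt (real m * (real m + 1)) * ln ((\<Prod>j=1..m. p j) / p (m + 1) ^ m)"
      unfolding ilr[symmetric] by (simp add: ilr_def k Let_def)
    also have "ln ((\<Prod>j=1..m. p j) / p (m + 1) ^ m) = (\<Sum>j=1..m. ln (p j)) - real m * ln (p (m + 1))"
    proof -
      have pp: "p j > 0" if "j \<in> {1..m+1}" for j using p[of j] m that by auto
      hence "(\<Prod>j=1..m. p j) > 0" by (intro prod_pos) auto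
      moreover have "p j \<noteq> 0" if "j \<in> {1..m+1}" for j using pp[OF that] by simp
      ultimately show ?thesis using pp
        by (subst ln_divide_pos) (auto simp: ln_realpow intro!: ln_prod)
    qed
    finally have "?L m = 1 / sqrt (real m * (real m + 1)) *
        ((\<Sum>j=1..m. ln (p j)) - real m * ln (p (m + 1)))" .
    moreover have "sqrt (real m * (real m + 1)) \<noteq> 0" using m by auto
    ultimately show ?thesis
      by (simp only: mult.assoc[symmetric] times_divide_eq_right mult_1_right divide_self mult_1_left not_False_eq_True)
  qed
  have "ln (p (m + 1)) = ln (p 1) - sqrt ((real m + 1) / real m) * ?L m
           - (\<Sum>j=1..m-1. ?L j / sqrt (real j * (real j + 1)))"
    by (rule ilr_recursion[OF step m])
  also have "\<dots> = ln (p 1) - tilt_vec m \<bullet> x"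
  proof -
    \<comment> \<open>The weight \<open>1 / (j + 1)\<close> in \<open>tilt_vec\<close> is what turns
      the scale factor of \<open>avec j\<close> into the ilr normalisation.\<close>
    have "(\<Sum>j=1..m-1. ?L j / sqrt (real j * (real j + 1))) = (\<Sum>j=1..m-1. (1 / (real j + 1)) *\<^sub>R avec j) \<bullet> x"
      unfolding inner_sum_left
    proof (intro sum.cong refl)
      fix j assume "j \<in> {1..m-1}"
      hence "?L j / sqrt (real j * (real j + 1)) = (1 / (real j + 1) * sqrt ((real j + 1) / real j)) * ?L j"
        by (subst sqrt_mult_Suc(2)) auto
      thus "?L j / sqrt (real j * (real j + 1)) = ((1 / (real j + 1)) *\<^sub>R avec j) \<bullet> x"
        by (simp add: avec_def)
    qed
    thus ?thesis by (simp add: tilt_vec_def inner_add_left avec_def)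
  qed
  finally have "exp (ln (p (m + 1))) = exp (ln (p 1)) * exp (- (tilt_vec m \<bullet> x))"
    by (simp add: exp_add[symmetric])
  thus ?thesis using p[of 1] p[of "m + 1"] m by simp
qed

section \<open>Normal densities under exponential tilting\<close>

lemma matrix_inv_invertible:
  fixes A :: "real ^ 'n ^ 'n"
  assumes "invertible A"
  shows "A ** matrix_inv A = mat 1" "matrix_inv A ** A = mat 1"
  using someI_ex[OF assms[unfolded invertible_def]] by (simp_all add: matrix_inv_def)

lemma sym_pos_def_inverse:
  fixes S :: "real ^ 'n ^ 'n"
  assumes "sym_pos_def S"
  shows "matrix_inv S *v (S *v x) = x" "y \<bullet> (matrix_inv S *v (S *v x)) = y \<bullet> x"
    "(S *v x) \<bullet> (matrix_inv S *v y) = x \<bullet> y"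
proof -
  have ker: "x = 0" if "S *v x = 0" for x
    using assms that by (force simp: sym_pos_def_def)
  have "invertible S"
    using ker by (simp add: invertible_left_inverse matrix_left_invertible_ker)
  note inv = matrix_inv_invertible[OF this]
  show *: "matrix_inv S *v (S *v x) = x" by (simp add: matrix_vector_mul_assoc inv)
  thus "y \<bullet> (matrix_inv S *v (S *v x)) = y \<bullet> x" by simp
  have "(S *v x) \<bullet> (matrix_inv S *v y) = x \<bullet> (S *v (matrix_inv S *v y))"
    using assms by (metis sym_pos_def_def dot_lmul_matrix transpose_matrix_vector)
  thus "(S *v x) \<bullet> (matrix_inv S *v y) = x \<bullet> y" by (simp add: matrix_vector_mul_assoc inv)
qed

text \<open>Completing the square in \<open>d = x - m\<close>: the inverse covariance cancels
  against \<open>S *v c\<close>, so the cross term is linear in \<open>d\<close>. The normalising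
  factor depends on \<open>S\<close> alone and is common to both densities.\<close>

lemma mvn_density_tilt:
  assumes "sym_pos_def S"
  shows "mvn_density m S x * exp (- (c \<bullet> x))
    = exp (c \<bullet> (S *v c) / 2 - c \<bullet> m) * mvn_density (m - S *v c) S x"
proof -
  have "(x - (m - S *v c)) \<bullet> (matrix_inv S *v (x - (m - S *v c)))
    = (x - m) \<bullet> (matrix_inv S *v (x - m)) + 2 * (c \<bullet> (x - m)) + c \<bullet> (S *v c)"
  proof -
    have "(d + S *v c) \<bullet> (matrix_inv S *v (d + S *v c))
      = d \<bullet> (matrix_inv S *v d) + 2 * (c \<bullet> d) + c \<bullet> (S *v c)" for d
      by (simp add: matrix_vector_right_distrib inner_add_left inner_add_right inner_commute
          sym_pos_def_inverse[OF assms])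
    from this[of "x - m"] show ?thesis by (simp add: algebra_simps)
  qed
  hence "- ((x - m) \<bullet> (matrix_inv S *v (x - m))) / 2 - c \<bullet> x = (c \<bullet> (S *v c) / 2 - c \<bullet> m)
     + - ((x - (m - S *v c)) \<bullet> (matrix_inv S *v (x - (m - S *v c)))) / 2"
    by (simp add: inner_diff_right field_simps)
  hence "exp (- ((x - m) \<bullet> (matrix_inv S *v (x - m))) / 2) * exp (- (c \<bullet> x)) = exp (c \<bullet> (S *v c) / 2 - c \<bullet> m)
     * exp (- ((x - (m - S *v c)) \<bullet> (matrix_inv S *v (x - (m - S *v c)))) / 2)"
    by (simp only: exp_add[symmetric] diff_conv_add_uminus)
  thus ?thesis by (simp add: mvn_density_def)
qed

lemma mvn_density_translate: "mvn_density (m - v) S x = mvn_density m S (v + x)"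
  by (simp add: mvn_density_def algebra_simps)

lemma nn_integral_distributed:
  assumes "prob_space M" "distributed M N X f"
  shows "(\<integral>\<^sup>+x. f x \<partial>N) = 1"
  using distributed_nn_integral[OF assms(2), of "\<lambda>_. 1"] prob_space.emeasure_space_1[OF assms(1)]
  by simp

text \<open>The Gaussian integral is never evaluated: the translate of the density of \<open>X\<close> has total
  mass 1 because \<open>M\<close> is a probability space. Comparing masses with \<open>g\<close> then shows that the
  constant of \<open>mvn_density_tilt\<close> is 1.\<close>

lemma mvn_distributed_tilt:
  fixes X Y :: "'a \<Rightarrow> real ^ 'n" and f g :: "real ^ 'n \<Rightarrow> real"
  assumes S: "sym_pos_def S"
    and "prob_space M" "prob_space M'"
    and M: "distributed M lborel X f" and M': "distributed M' lborel Y g"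
    and f: "\<And>x. f x > (0::real)" and g: "\<And>x. g x = f x * exp (- (c \<bullet> x))"
    and mvn: "mvn_distributed M X m S"
  shows "mvn_distributed M' Y (m - S *v c) S" and "2 * (c \<bullet> m) = c \<bullet> (S *v c)"
proof -
  let ?h = "mvn_density m S" and ?h' = "mvn_density (m - S *v c) S"
  let ?K = "exp (c \<bullet> (S *v c) / 2 - c \<bullet> m)"
  have h: "distributed M lborel X ?h" using mvn by (simp add: mvn_distributed_def)
  have [measurable]: "(\<lambda>x. ennreal (?h x)) \<in> borel_measurable borel"
    using distributed_borel_measurable[OF h] by simp
  \<comment> \<open>A shifted mean is a translated argument, so measurability and, by invariance of
    Lebesgue measure, total mass carry over from \<open>?h\<close>.\<close>
  have h'_eq: "?h' = (\<lambda>x. ?h (S *v c + x))" by (simp add: fun_eq_iff mvn_density_translate)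
  have h'_meas[measurable]: "(\<lambda>x. ennreal (?h' x)) \<in> borel_measurable borel" unfolding h'_eq by measurable
  have "(\<integral>\<^sup>+x. ?h' x \<partial>lborel) = (\<integral>\<^sup>+x. ?h x \<partial>distr lborel borel ((+) (S *v c)))"
    unfolding h'_eq by (subst nn_integral_distr) auto
  also have "\<dots> = 1"
    by (simp add: lborel_distr_plus nn_integral_distributed[OF assms(2) h])
  finally have int_h': "(\<integral>\<^sup>+x. ?h' x \<partial>lborel) = 1" .
  \<comment> \<open>Two densities of the same variable need agree only almost everywhere, so
    \<open>g\<close> is compared with \<open>?h'\<close> almost everywhere.\<close>
  have "AE x in lborel. ennreal (f x) = ennreal (?h x)"
    by (rule prob_space.distributed_unique[OF assms(2) M h])
  hence ae: "AE x in lborel. ennreal (g x) = ennreal ?K * ennreal (?h' x)"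
  proof eventually_elim
    case (elim x)
    \<comment> \<open>\<open>ennreal\<close> sends negative reals to 0; positivity of
      \<open>f x\<close> excludes that case and gives equality of reals.\<close>
    have "f x = ?h x" using elim f[of x]
      by (metis ennreal_inj ennreal_neg ennreal_eq_0_iff less_le_not_le linear)
    hence "g x = ?K * ?h' x" by (simp add: g mvn_density_tilt[OF S])
    thus ?case by (simp add: ennreal_mult')
  qed
  have "1 = (\<integral>\<^sup>+x. g x \<partial>lborel)" using nn_integral_distributed[OF assms(3) M'] by simp
  also have "\<dots> = (\<integral>\<^sup>+x. ennreal ?K * ennreal (?h' x) \<partial>lborel)" by (rule nn_integral_cong_AE[OF ae])
  also have "\<dots> = ennreal ?K" by (subst nn_integral_cmult) (auto simp: int_h')
  finally have K: "?K = 1" by (metis ennreal_eq_1)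
  \<comment> \<open>An exponential equal to 1 has exponent 0.\<close>
  thus "2 * (c \<bullet> m) = c \<bullet> (S *v c)" by simp
  show "mvn_distributed M' Y (m - S *v c) S"
    unfolding mvn_distributed_def
    by (rule iffD1[OF distributed_cong_density M'])
      (use ae K distributed_borel_measurable[OF M'] in auto)
qed

theorem theorem4:
  fixes D :: nat
    and P :: "nat \<Rightarrow> 'a measure"
    and l :: "'a \<Rightarrow> real ^ 'n::{finite,wellorder}"
    and f :: "nat \<Rightarrow> real ^ 'n::_ \<Rightarrow> real"
    and \<mu>\<^sub>1 :: "real ^ 'n::_"
    and \<Sigma> :: "real ^ ('n::_) ^ ('n::_)"
  assumes "D \<ge> 2" and "CARD('n) = D - 1"
    and "\<And>i. i \<in> {1..D} \<Longrightarrow> prob_space (P i)"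
    and "\<And>i. i \<in> {1..D} \<Longrightarrow> sets (P i) = sets (P 1)"
    and "\<And>i. i \<in> {1..D} \<Longrightarrow> distributed (P i) lborel l (f i)"
    and "\<And>i x. i \<in> {1..D} \<Longrightarrow> f i x > 0"
    and "\<And>x. ilr (\<lambda>i. f i x) = x"
    and "sym_pos_def \<Sigma>"
    and "mvn_distributed (P 1) l \<mu>\<^sub>1 \<Sigma>"
  shows "(\<forall>i\<in>{2..D}. mvn_distributed (P i) l
           (\<mu>\<^sub>1 - \<Sigma> *v avec (i - 1) - (\<Sum>j=1..i-2. (1 / (real j + 1)) *\<^sub>R (\<Sigma> *v avec j))) \<Sigma>)
         \<and> \<mu>\<^sub>1 = matrix_inv Amat *v (Bmat *v vectorize \<Sigma>)"
proof -
  have tilted: "mvn_distributed (P i) l (\<mu>\<^sub>1 - \<Sigma> *v tilt_vec (i - 1)) \<Sigma>"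
      "2 * (tilt_vec (i - 1) \<bullet> \<mu>\<^sub>1) = tilt_vec (i - 1) \<bullet> (\<Sigma> *v tilt_vec (i - 1))"
    if i: "i \<in> {2..D}" for i
  proof -
    \<comment> \<open>The index matches \<open>p (m + 1)\<close> with \<open>m = i - 1\<close>; it
      equals \<open>i\<close> because \<open>i\<close> is at least 2.\<close>
    have "f (i - 1 + 1) x = f 1 x * exp (- (tilt_vec (i - 1) \<bullet> x))" for x
      by (rule ilr_fixed_point[OF assms(7)]) (use assms(1,2,6) i in auto)
    hence "f i x = f 1 x * exp (- (tilt_vec (i - 1) \<bullet> x))" for x
      using i by simp
    note * = mvn_distributed_tilt[OF assms(8) assms(3) assms(3) assms(5) assms(5) assms(6) this assms(9)]
    show "mvn_distributed (P i) l (\<mu>\<^sub>1 - \<Sigma> *v tilt_vec (i - 1)) \<Sigma>"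
      "2 * (tilt_vec (i - 1) \<bullet> \<mu>\<^sub>1) = tilt_vec (i - 1) \<bullet> (\<Sigma> *v tilt_vec (i - 1))"
      using * i by auto
  qed
  have "\<Sigma> *v tilt_vec (i - 1) = \<Sigma> *v avec (i - 1) + (\<Sum>j=1..i-2. (1 / (real j + 1)) *\<^sub>R (\<Sigma> *v avec j))" for i
    by (simp add: tilt_vec_def matrix_vector_right_distrib matrix_vector_mult_scaleR
          linear_sum[OF matrix_vector_mul_linear] numeral_2_eq_2)
  hence "\<forall>i\<in>{2..D}. mvn_distributed (P i) l
           (\<mu>\<^sub>1 - \<Sigma> *v avec (i - 1) - (\<Sum>j=1..i-2. (1 / (real j + 1)) *\<^sub>R (\<Sigma> *v avec j))) \<Sigma>"
    using tilted(1) by (simp add: diff_diff_eq)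
  moreover have "Amat *v \<mu>\<^sub>1 = Bmat *v vectorize \<Sigma>"
  proof (rule vec_eq_iff[THEN iffD2], rule allI)
    fix r :: 'n
    \<comment> \<open>Row \<open>r\<close> of the system is the mass equation of hypothesis number
      \<open>pos r + 1\<close>.\<close>
    have "pos r + 1 \<in> {2..D}"
      using bij_betw_apply[OF bij_betw_pos, of r] assms(1,2) by auto
    from tilted(2)[OF this] assms(8) show "(Amat *v \<mu>\<^sub>1) $ r = (Bmat *v vectorize \<Sigma>) $ r"
      by (simp add: Amat_mult Bmat_mult sym_pos_def_def)
  qed
  hence "\<mu>\<^sub>1 = matrix_inv Amat *v (Bmat *v vectorize \<Sigma>)"
    by (metis invertible_Amat matrix_inv_invertible(2) matrix_vector_mul_assoc matrix_vector_mul_lid)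
  ultimately show ?thesis by blast
qed

end
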